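(* Let $F\subset\mathbb{R}^n$ be bounded, let $\Phi$ be an admissible gauge function, and fix an integer $1\le m\le n$ and $s\in[0,m]$. Suppose there exist constants $r_0>0$ and $M>0$, and a probability measure $\nu\in M(F)$ such that for all $0<r\le r_0$, \[ \int\varphi^{r,\Phi}_{s,m}(x-y)\,d\nu(y)\le M\,\Phi(r)^s\qquad\text{for all }x\in F. \] Then \[ \underline{\dim}^{\,m}_\Phi(F)\ge s\qquad\text{and}\qquad\overline{\dim}^{\,m}_\Phi(F)\ge s. \] In particular, if $m=n$, then \[ \underline{\dim}_\Phi(F)\ge s\qquad\text{and}\qquad\overline{\dim}_\Phi(F)\ge s. \]
   Context: A function $\Phi:(0,1]\to(0,1]$ is an admissible gauge function if $0<\Phi(r)\le r$ for all sufficiently small $r>0$ and $\Phi(r)/r\to0$ as $r\to0$. $|U|$ denotes the diameter of $U$. For a non-empty bounded set $E\subset\mathbb{R}^n$, the lower $\Phi$-intermediate dimension $\underline{\dim}_\Phi E$ is the infimum of all $s\ge0$ such that for all $\epsilon>0$ and all $r_0>0$ there exist $0<r\le r_0$ and a cover $\{U_i\}$ of $E$ with $\Phi(r)\le|U_i|\le r$ for all $i$ and $\sum_i|U_i|^s\le\epsilon$. The upper $\Phi$-intermediate dimension $\overline{\dim}_\Phi E$ is the infimum of all $s\ge0$ such that for all $\epsilon>0$ there exists $r_0>0$ such that for all $0<r\le r_0$ there is a cover $\{U_i\}$ of $E$ with $\Phi(r)\le|U_i|\le r$ for all $i$ and $\sum_i|U_i|^s\le\epsilon$. For $1\le m\le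 n$, $s\in[0,m]$ and $r\in(0,1]$ with $\Phi(r)\le r$, define $\varphi^{r,\Phi}_{s,m}:\mathbb{R}^n\to[0,\infty)$ by \[ \varphi^{r,\Phi}_{s,m}(x)=\begin{cases}1,&\|x\|<\Phi(r),\\ \left(\Phi(r)/\|x\|\right)^s,&\Phi(r)\le\|x\|<r,\\ \left(\Phi(r)/r\right)^s\left(r/\|x\|\right)^m,&\|x\|\ge r,\end{cases} \] with $\|\cdot\|$ the Euclidean norm. Let $M(E)$ be the set of Borel probability measures supported on $E$ (not to be confused with the constant $M$). For $\mu\in M(E)$ let $\mathcal{I}^{\,r,\Phi}_{s,m}(\mu)=\iint\varphi^{r,\Phi}_{s,m}(x-y)\,d\mu(x)\,d\mu(y)$, and let $C^{\,r,\Phi}_{s,m}(E)=\left(\inf_{\mu\in M(E)}\mathcal{I}^{\,r,\Phi}_{s,m}(\mu)\right)^{-1}$. The $\Phi$-intermediate dimension profiles of a non-empty bounded set $E$ in dimension $m$ are \[ \underline{\dim}^{\,m}_\Phi E=\sup\left\{s\in[0,m]:\liminf_{r\to0}\frac{\log C^{\,r,\Phi}_{s,m}(E)}{-\log\Phi(r)}\ge s\right\},\qquad \overline{\dim}^{\,m}_\Phi E=\sup\left\{s\in[0,m]:\limsup_{r\to0}\frac{\log C^{\,r,\Phi}_{s,m}(E)}{-\log\Phi(r)}\ge s\right\}. \] *)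

theory Defs
  imports "HOL-Probability.Probability"
begin

text \<open>
  A gauge function \<open>\<Phi>\<close> is only meaningful on \<open>(0,1]\<close>; its values elsewhere are arbitrary. The
  definitions below depend on \<open>\<Phi>\<close> only through its values at arbitrarily small positive arguments.
\<close>

definition admissible_gauge :: "(real \<Rightarrow> real) \<Rightarrow> bool" where
  "admissible_gauge \<Phi> \<longleftrightarrow>
     (\<forall>r\<in>{0<..1}. \<Phi> r \<in> {0<..1}) \<and>
     (\<forall>\<^sub>F r in at_right 0. 0 < \<Phi> r \<and> \<Phi> r \<le> r) \<and>
     ((\<lambda>r. \<Phi> r / r) \<longlongrightarrow> 0) (at_right 0)"

text \<open>
  Boundedness of the members is explicit because \<^const>\<open>diameter\<close> carries no information for
  unbounded sets. The sums are taken in \<^typ>\<open>ennreal\<close>, so that divergence counts as \<open>\<infinity>\<close>.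
\<close>

definition gauge_cover ::
    "(real \<Rightarrow> real) \<Rightarrow> real \<Rightarrow> (real ^ 'n) set \<Rightarrow> (real ^ 'n) set set \<Rightarrow> bool" where
  "gauge_cover \<Phi> r E \<U> \<longleftrightarrow> countable \<U> \<and> E \<subseteq> \<Union>\<U> \<and>
     (\<forall>U\<in>\<U>. bounded U \<and> \<Phi> r \<le> diameter U \<and> diameter U \<le> r)"

definition cover_sum :: "real \<Rightarrow> (real ^ 'n) set set \<Rightarrow> ennreal" where
  "cover_sum s \<U> = (\<Sum>\<^sub>\<infinity>U\<in>\<U>. ennreal (diameter U powr s))"

definition lower_intermediate_dim :: "(real \<Rightarrow> real) \<Rightarrow> (real ^ 'n) set \<Rightarrow> ereal" where
  "lower_intermediate_dim \<Phi> E = Inf {ereal s | s. 0 \<le> s \<and>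
     (\<forall>\<epsilon>>0. \<forall>r0>0. \<exists>r. 0 < r \<and> r \<le> r0 \<and>
        (\<exists>\<U>. gauge_cover \<Phi> r E \<U> \<and> cover_sum s \<U> \<le> ennreal \<epsilon>))}"

definition upper_intermediate_dim :: "(real \<Rightarrow> real) \<Rightarrow> (real ^ 'n) set \<Rightarrow> ereal" where
  "upper_intermediate_dim \<Phi> E = Inf {ereal s | s. 0 \<le> s \<and>
     (\<forall>\<epsilon>>0. \<exists>r0>0. \<forall>r. 0 < r \<and> r \<le> r0 \<longrightarrow>
        (\<exists>\<U>. gauge_cover \<Phi> r E \<U> \<and> cover_sum s \<U> \<le> ennreal \<epsilon>))}"

definition gauge_kernel ::
    "(real \<Rightarrow> real) \<Rightarrow> real \<Rightarrow> real \<Rightarrow> nat \<Rightarrow> real ^ 'n \<Rightarrow> real" where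
  "gauge_kernel \<Phi> r s m x =
     (if norm x < \<Phi> r then 1
      else if norm x < r then (\<Phi> r / norm x) powr s
      else (\<Phi> r / r) powr s * (r / norm x) ^ m)"

text \<open>
  The condition \<open>AE x in \<mu>. x \<in> E\<close> says that \<open>\<mu>\<close> gives full mass to some Borel subset of \<open>E\<close>;
  \<open>E\<close> itself need be neither closed nor Borel.
\<close>

definition prob_measures_on :: "(real ^ 'n) set \<Rightarrow> (real ^ 'n) measure set" where
  "prob_measures_on E = {\<mu>. prob_space \<mu> \<and> sets \<mu> = sets borel \<and> (AE x in \<mu>. x \<in> E)}"

definition gauge_energy ::
    "(real \<Rightarrow> real) \<Rightarrow> real \<Rightarrow> real \<Rightarrow> nat \<Rightarrow> (real ^ 'n) measure \<Rightarrow> real" where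
  "gauge_energy \<Phi> r s m \<mu> = (LINT y|\<mu>. LINT x|\<mu>. gauge_kernel \<Phi> r s m (x - y))"

text \<open>
  For bounded \<open>E\<close> carrying a probability measure and \<open>0 < \<Phi> r \<le> r\<close>, the kernel takes values in
  \<open>(0,1]\<close> and is bounded away from \<open>0\<close> on \<open>E - E\<close>, so the infimum lies in \<open>(0,1]\<close>
  and neither the inverse nor the logarithm below is degenerate.
\<close>

definition gauge_capacity ::
    "(real \<Rightarrow> real) \<Rightarrow> real \<Rightarrow> real \<Rightarrow> nat \<Rightarrow> (real ^ 'n) set \<Rightarrow> real" where
  "gauge_capacity \<Phi> r s m E = inverse (INF \<mu>\<in>prob_measures_on E. gauge_energy \<Phi> r s m \<mu>)"

definition lower_dim_profile :: "(real \<Rightarrow> real) \<Rightarrow> nat \<Rightarrow> (real ^ 'n) set \<Rightarrow> ereal" where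
  "lower_dim_profile \<Phi> m E = Sup {ereal s | s. s \<in> {0..real m} \<and>
     Liminf (at_right 0) (\<lambda>r. ereal (ln (gauge_capacity \<Phi> r s m E) / - ln (\<Phi> r))) \<ge> ereal s}"

definition upper_dim_profile :: "(real \<Rightarrow> real) \<Rightarrow> nat \<Rightarrow> (real ^ 'n) set \<Rightarrow> ereal" where
  "upper_dim_profile \<Phi> m E = Sup {ereal s | s. s \<in> {0..real m} \<and>
     Limsup (at_right 0) (\<lambda>r. ereal (ln (gauge_capacity \<Phi> r s m E) / - ln (\<Phi> r))) \<ge> ereal s}"

end

theory Submission
  imports Defs
begin

text \<open>
  Both halves of the theorem read the same hypothesis, that the potential of \<open>\<nu>\<close> at scale \<open>r\<close> is
  at most \<open>M * \<Phi> r powr s\<close> on \<open>F\<close>, in two different ways.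

  For the profiles, integrate the potential once more against \<open>\<nu>\<close>: the energy of \<open>\<nu>\<close> is at most
  \<open>M * \<Phi> r powr s\<close>, so the capacity is at least the reciprocal of this number, and dividing its
  logarithm by \<open>- ln (\<Phi> r)\<close> gives at least \<open>s - ln M / - ln (\<Phi> r)\<close>. The second term vanishes in the
  limit because \<open>\<Phi> r\<close> tends to \<open>0\<close>. The capacity is the reciprocal of an infimum of energies, so this
  needs the infimum to be nonzero; it is, because on the bounded set \<open>F\<close> the kernel stays above
  a positive constant that does not depend on the measure.

  For the intermediate dimensions, the potential serves as a mass distribution principle. On a
  set \<open>U\<close> of diameter \<open>d\<close> with \<open>\<Phi> r \<le> d \<le> r\<close> the kernel \<open>\<lambda>y. gauge_kernel \<Phi> r s m (x - y)\<close> is at least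
  \<open>(\<Phi> r / d) powr s\<close> when \<open>x\<close> and \<open>y\<close> lie in \<open>U\<close>. Taking \<open>x \<in> U \<inter> F\<close> yields \<open>(\<Phi> r / d) powr s * \<nu> U \<le> M * \<Phi> r powr s\<close>,
  that is, \<open>\<nu> U \<le> M * d powr s\<close>. Summing over a cover gives \<open>1 \<le> M * cover_sum s \<U>\<close>, so the cover
  sums cannot become small. A cover sum with a smaller exponent is at least as large, the diameters being
  at most \<open>1\<close>, so no exponent below \<open>s\<close> is admitted to the infimum that defines the lower
  dimension. The upper dimension is an infimum over a smaller set of exponents.
\<close>

section \<open>The kernel\<close>

lemma gauge_kernel_minus_commute: "gauge_kernel \<Phi> r s m (x - y) = gauge_kernel \<Phi> r s m (y - x)"
  by (simp add: gauge_kernel_def norm_minus_commute)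

lemma gauge_kernel_measurable [measurable]:
  "gauge_kernel \<Phi> r s m \<in> borel_measurable (borel :: (real ^ 'n) measure)"
  unfolding gauge_kernel_def by measurable

lemma gauge_kernel_nonneg:
  assumes "0 < r"
  shows "0 \<le> gauge_kernel \<Phi> r s m x"
  using assms by (simp add: gauge_kernel_def)

lemma gauge_kernel_le_1:
  assumes "0 < \<Phi> r" "\<Phi> r \<le> r" "0 \<le> s"
  shows "gauge_kernel \<Phi> r s m x \<le> 1"
proof -
  have le1: "a powr s \<le> 1" if "0 \<le> a" "a \<le> 1" for a :: real
    using that \<open>0 \<le> s\<close> by (simp add: powr_le1)
  have "(\<Phi> r / r) powr s * (r / norm x) ^ m \<le> 1 * 1" if "r \<le> norm x"
    using assms that by (intro mult_mono le1 power_le_one) (auto simp: divide_le_eq_1)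
  then show ?thesis
    using assms by (auto simp: gauge_kernel_def divide_le_eq_1 intro!: le1)
qed

text \<open>
  The kernel does not increase with the norm, and at norm \<open>d \<in> {\<Phi> r..r}\<close> its value is \<open>(\<Phi> r / d) powr s\<close>; at
  \<open>d = r\<close> the second and the third branch agree.
\<close>

lemma gauge_kernel_ge_near:
  assumes "0 < \<Phi> r" "\<Phi> r \<le> d" "d \<le> r" "0 \<le> s" "norm x \<le> d"
  shows "(\<Phi> r / d) powr s \<le> gauge_kernel \<Phi> r s m x"
proof -
  have "(\<Phi> r / d) powr s \<le> 1"
    using assms by (simp add: powr_le1)
  moreover have "(\<Phi> r / d) powr s \<le> (\<Phi> r / norm x) powr s" if "\<Phi> r \<le> norm x"
    using assms that by (intro powr_mono2 divide_left_mono mult_pos_pos) auto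
  moreover have "(\<Phi> r / d) powr s = (\<Phi> r / r) powr s * (r / norm x) ^ m" if "r \<le> norm x"
  proof -
    have "norm x = r" "d = r" using assms that by auto
    then show ?thesis using assms by simp
  qed
  ultimately show ?thesis
    using assms by (auto simp: gauge_kernel_def)
qed

lemma gauge_kernel_ge_far:
  assumes "0 < \<Phi> r" "\<Phi> r \<le> r" "r \<le> D" "0 \<le> s" "norm x \<le> D"
  shows "(\<Phi> r / r) powr s * (r / D) ^ m \<le> gauge_kernel \<Phi> r s m x"
proof (cases "norm x \<le> r")
  case True
  have "(\<Phi> r / r) powr s * (r / D) ^ m \<le> (\<Phi> r / r) powr s"
    using assms by (intro mult_right_le_one_le power_le_one) auto
  also have "\<dots> \<le> gauge_kernel \<Phi> r s m x"
    using assms True by (intro gauge_kernel_ge_near) auto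
  finally show ?thesis .
next
  case False
  then have "(r / D) ^ m \<le> (r / norm x) ^ m"
    using assms by (intro power_mono divide_left_mono mult_pos_pos) auto
  then show ?thesis
    using assms False by (auto simp: gauge_kernel_def intro!: mult_left_mono)
qed

lemma integrable_gauge_kernel:
  fixes \<mu> :: "(real ^ 'n) measure"
  assumes "\<mu> \<in> prob_measures_on E" "0 < \<Phi> r" "\<Phi> r \<le> r" "0 \<le> s"
  shows "integrable \<mu> (\<lambda>y. gauge_kernel \<Phi> r s m (x - y))"
proof -
  interpret prob_space \<mu> using assms by (simp add: prob_measures_on_def)
  have [measurable_cong]: "sets \<mu> = sets borel" using assms by (simp add: prob_measures_on_def)
  have "norm (gauge_kernel \<Phi> r s m (x - y)) \<le> 1" for y
    using assms gauge_kernel_le_1[of \<Phi> r s m "x - y"] gauge_kernel_nonneg[of r \<Phi> s m "x - y"]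
    by simp
  then show ?thesis
    by (intro integrable_const_bound[where B = 1]) auto
qed

section \<open>Capacity and the dimension profiles\<close>

lemma gauge_energy_ge:
  fixes \<mu> :: "(real ^ 'n) measure"
  assumes \<mu>: "\<mu> \<in> prob_measures_on E"
    and \<Phi>: "0 < \<Phi> r" "\<Phi> r \<le> r" "0 \<le> s"
    and lower: "\<And>x y. x \<in> E \<Longrightarrow> y \<in> E \<Longrightarrow> c \<le> gauge_kernel \<Phi> r s m (x - y)"
  shows "c \<le> gauge_energy \<Phi> r s m \<mu>"
proof -
  interpret prob_space \<mu> using \<mu> by (simp add: prob_measures_on_def)
  have [measurable_cong]: "sets \<mu> = sets borel" using \<mu> by (simp add: prob_measures_on_def)
  have AE: "AE x in \<mu>. x \<in> E" using \<mu> by (simp add: prob_measures_on_def)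
  define p where "p = (\<lambda>y. LINT x|\<mu>. gauge_kernel \<Phi> r s m (x - y))"
  have int: "integrable \<mu> (\<lambda>x. gauge_kernel \<Phi> r s m (x - y))" for y
    using integrable_gauge_kernel[where \<Phi> = \<Phi> and r = r, OF \<mu> \<Phi>, of m y] by (simp add: gauge_kernel_minus_commute)
  have "c \<le> p y" if "y \<in> E" for y
    unfolding p_def using AE by (intro integral_ge_const int) (auto simp: lower that)
  then have ge: "AE y in \<mu>. c \<le> p y" using AE by auto
  have "0 \<le> p y" "p y \<le> 1" for y
    unfolding p_def using \<Phi> gauge_kernel_le_1[of \<Phi> r s m] gauge_kernel_nonneg[of r \<Phi> s m]
    by (auto intro!: integral_nonneg_AE integral_le_const int)
  moreover have "p \<in> borel_measurable \<mu>"
    unfolding p_def by measurable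
  ultimately have "integrable \<mu> p"
    by (intro integrable_const_bound[where B = 1]) auto
  from integral_ge_const[OF this ge] show ?thesis
    by (simp add: gauge_energy_def p_def)
qed

text \<open>
  Boundedness of \<open>E\<close> enters only to keep the infimum of the energies away from \<open>0\<close>, where
  \<^const>\<open>inverse\<close> would take the value \<open>0\<close> instead of \<open>\<infinity>\<close>.
\<close>

lemma gauge_capacity_ge:
  fixes \<nu> :: "(real ^ 'n) measure"
  assumes "bounded E" and \<nu>: "\<nu> \<in> prob_measures_on E"
    and \<Phi>: "0 < \<Phi> r" "\<Phi> r \<le> r" "0 \<le> s"
    and potential: "\<And>x. x \<in> E \<Longrightarrow> (LINT y|\<nu>. gauge_kernel \<Phi> r s m (x - y)) \<le> b"
  shows "0 < b" "inverse b \<le> gauge_capacity \<Phi> r s m E"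
proof -
  interpret prob_space \<nu> using \<nu> by (simp add: prob_measures_on_def)
  have AE: "AE x in \<nu>. x \<in> E" using \<nu> by (simp add: prob_measures_on_def)
  define D where "D = max r (diameter E)"
  define c where "c = (\<Phi> r / r) powr s * (r / D) ^ m"
  have "0 < r" using \<Phi> by simp
  moreover from this have "0 < D" by (simp add: D_def)
  ultimately have "0 < c" using \<Phi> by (simp add: c_def)
  have c_le: "c \<le> gauge_energy \<Phi> r s m \<mu>" if "\<mu> \<in> prob_measures_on E" for \<mu>
  proof (intro gauge_energy_ge[where \<Phi> = \<Phi> and r = r, OF that \<Phi>])
    fix x y assume "x \<in> E" "y \<in> E"
    then have "norm (x - y) \<le> D"
      using diameter_bounded_bound[OF \<open>bounded E\<close>] by (force simp: D_def dist_norm)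
    then show "c \<le> gauge_kernel \<Phi> r s m (x - y)"
      unfolding c_def using \<Phi> by (intro gauge_kernel_ge_far) (auto simp: D_def)
  qed
  define p where "p = (\<lambda>y. LINT x|\<nu>. gauge_kernel \<Phi> r s m (x - y))"
  have p_le: "AE y in \<nu>. p y \<le> b"
    using AE by eventually_elim (use potential in \<open>simp add: p_def gauge_kernel_minus_commute\<close>)
  have energy: "gauge_energy \<Phi> r s m \<nu> = integral\<^sup>L \<nu> p"
    by (simp add: gauge_energy_def p_def)
  \<comment> \<open>The integral of a non-integrable function is \<open>0\<close>, which the positive lower bound excludes.\<close>
  have "integrable \<nu> p"
    using c_le[OF \<nu>] \<open>0 < c\<close> not_integrable_integral_eq[of \<nu> p] by (auto simp: energy)
  then have energy_le: "gauge_energy \<Phi> r s m \<nu> \<le> b"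
    using p_le by (simp add: energy integral_le_const)
  then show "0 < b" using c_le[OF \<nu>] \<open>0 < c\<close> by simp
  let ?I = "INF \<mu>\<in>prob_measures_on E. gauge_energy \<Phi> r s m \<mu>"
  have "c \<le> ?I" using \<nu> c_le by (intro cINF_greatest) auto
  moreover have "?I \<le> b"
    using energy_le \<nu> c_le by (intro cINF_lower2[of _ _ \<nu>] bdd_belowI2[of _ c]) auto
  ultimately show "inverse b \<le> gauge_capacity \<Phi> r s m E"
    unfolding gauge_capacity_def using \<open>0 < c\<close> by (intro le_imp_inverse_le) auto
qed

lemma admissible_gauge_eventually:
  assumes "admissible_gauge \<Phi>" "0 < r0"
  shows "\<forall>\<^sub>F r in at_right 0. 0 < r \<and> r \<le> r0 \<and> r \<le> 1 \<and> 0 < \<Phi> r \<and> \<Phi> r \<le> r"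
proof -
  have "\<forall>\<^sub>F r in at_right 0. 0 < r \<and> r < min r0 1"
    using assms(2) unfolding eventually_at_right_field by (intro exI[of _ "min r0 1"]) auto
  moreover have "\<forall>\<^sub>F r in at_right 0. 0 < \<Phi> r \<and> \<Phi> r \<le> r"
    using assms(1) by (simp add: admissible_gauge_def)
  ultimately show ?thesis by eventually_elim auto
qed

lemma admissible_gauge_neg_ln_at_top:
  assumes "admissible_gauge \<Phi>"
  shows "filterlim (\<lambda>r. - ln (\<Phi> r)) at_top (at_right 0)"
proof -
  have ev: "\<forall>\<^sub>F r in at_right 0. 0 < \<Phi> r \<and> \<Phi> r \<le> r"
    using assms by (simp add: admissible_gauge_def)
  have "(\<Phi> \<longlongrightarrow> 0) (at_right 0)"
    by (rule tendsto_sandwich[OF _ _ tendsto_const tendsto_ident_at])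
      (use ev in \<open>auto elim: eventually_mono\<close>)
  then have "filterlim \<Phi> (at_right 0) (at_right 0)"
    using ev by (auto simp: filterlim_at elim: eventually_mono)
  then have "filterlim (\<lambda>r. ln (\<Phi> r)) at_bot (at_right 0)"
    by (rule filterlim_compose[OF ln_at_0])
  then show ?thesis by (simp add: filterlim_uminus_at_bot)
qed

lemma Liminf_ln_gauge_capacity_ge:
  fixes \<nu> :: "(real ^ 'n) measure"
  assumes "bounded E" "admissible_gauge \<Phi>" "0 \<le> s" "0 < M" "\<nu> \<in> prob_measures_on E"
    and potential: "\<forall>\<^sub>F r in at_right 0. \<forall>x\<in>E.
      (LINT y|\<nu>. gauge_kernel \<Phi> r s m (x - y)) \<le> M * \<Phi> r powr s"
  shows "ereal s \<le> Liminf (at_right 0) (\<lambda>r. ereal (ln (gauge_capacity \<Phi> r s m E) / - ln (\<Phi> r)))"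
proof -
  have top: "filterlim (\<lambda>r. - ln (\<Phi> r)) at_top (at_right 0)"
    by (rule admissible_gauge_neg_ln_at_top) fact
  have "((\<lambda>r. s - ln M / - ln (\<Phi> r)) \<longlongrightarrow> s - 0) (at_right 0)"
    by (intro tendsto_diff tendsto_const tendsto_divide_0[OF tendsto_const]
          filterlim_at_top_imp_at_infinity top)
  then have "((\<lambda>r. ereal (s - ln M / - ln (\<Phi> r))) \<longlongrightarrow> ereal s) (at_right 0)"
    by simp
  then have "ereal s = Liminf (at_right 0) (\<lambda>r. ereal (s - ln M / - ln (\<Phi> r)))"
    by (intro lim_imp_Liminf[symmetric]) auto
  also have "\<dots> \<le> Liminf (at_right 0) (\<lambda>r. ereal (ln (gauge_capacity \<Phi> r s m E) / - ln (\<Phi> r)))"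
  proof (rule Liminf_mono)
    have "\<forall>\<^sub>F r in at_right 0. 0 < - ln (\<Phi> r)"
      using top unfolding filterlim_at_top_dense by blast
    with potential admissible_gauge_eventually[OF \<open>admissible_gauge \<Phi>\<close> zero_less_one]
    show "\<forall>\<^sub>F r in at_right 0. ereal (s - ln M / - ln (\<Phi> r))
        \<le> ereal (ln (gauge_capacity \<Phi> r s m E) / - ln (\<Phi> r))"
    proof eventually_elim
      case (elim r)
      then have "inverse (M * \<Phi> r powr s) \<le> gauge_capacity \<Phi> r s m E"
        using assms by (intro gauge_capacity_ge(2)[where \<nu> = \<nu>]) auto
      moreover have "0 < M * \<Phi> r powr s" using elim assms by simp
      then have "0 < inverse (M * \<Phi> r powr s)" by (rule positive_imp_inverse_positive)
      ultimately have "ln (inverse (M * \<Phi> r powr s)) \<le> ln (gauge_capacity \<Phi> r s m E)"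
        by (intro ln_mono)
      moreover have "ln (inverse (M * \<Phi> r powr s)) = s * - ln (\<Phi> r) - ln M"
        using elim assms by (simp add: ln_inverse ln_mult ln_powr)
      ultimately have "(s * - ln (\<Phi> r) - ln M) / - ln (\<Phi> r)
          \<le> ln (gauge_capacity \<Phi> r s m E) / - ln (\<Phi> r)"
        using elim by (intro divide_right_mono) auto
      moreover have "(s * - ln (\<Phi> r) - ln M) / - ln (\<Phi> r) = s - ln M / - ln (\<Phi> r)"
        using elim by (simp add: diff_divide_distrib)
      ultimately show ?case by simp
    qed
  qed
  finally show ?thesis .
qed

section \<open>Mass distribution and the intermediate dimensions\<close>

lemma emeasure_UN_le_infsum:
  assumes "countable I" and sets: "\<And>i. i \<in> I \<Longrightarrow> A i \<in> sets \<mu>"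
  shows "emeasure \<mu> (\<Union>i\<in>I. A i) \<le> (\<Sum>\<^sub>\<infinity>i\<in>I. emeasure \<mu> (A i))"
proof -
  let ?N = "to_nat_on I ` I"
  \<comment> \<open>Indices outside \<open>?N\<close> get the empty set: \<^const>\<open>from_nat_into\<close> would repeat members of \<open>I\<close>.\<close>
  define B where "B k = (if k \<in> ?N then A (from_nat_into I k) else {})" for k
  have "(\<Union>i\<in>I. A i) = (\<Union>k. B k)"
    using \<open>countable I\<close> by (auto simp: B_def split: if_splits)
  moreover have "emeasure \<mu> (\<Union>k. B k) \<le> (\<Sum>k. emeasure \<mu> (B k))"
    using \<open>countable I\<close> sets by (intro emeasure_subadditive_countably) (auto simp: B_def)
  moreover have "(\<Sum>k<n. emeasure \<mu> (B k)) \<le> (\<Sum>\<^sub>\<infinity>i\<in>I. emeasure \<mu> (A i))" for n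
  proof -
    let ?J = "{..<n} \<inter> ?N"
    have inj: "inj_on (from_nat_into I) ?J"
      using \<open>countable I\<close> by (auto intro!: inj_onI)
    have "(\<Sum>k<n. emeasure \<mu> (B k)) = (\<Sum>k\<in>?J. emeasure \<mu> (A (from_nat_into I k)))"
      by (intro sum.mono_neutral_cong_right) (auto simp: B_def)
    also have "\<dots> = (\<Sum>i\<in>from_nat_into I ` ?J. emeasure \<mu> (A i))"
      by (simp add: sum.reindex[OF inj])
    also have "\<dots> \<le> (\<Sum>\<^sub>\<infinity>i\<in>I. emeasure \<mu> (A i))"
      using \<open>countable I\<close> by (auto simp: nonneg_infsum_complete intro!: SUP_upper)
    finally show ?thesis .
  qed
  then have "(\<Sum>k. emeasure \<mu> (B k)) \<le> (\<Sum>\<^sub>\<infinity>i\<in>I. emeasure \<mu> (A i))"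
    by (intro suminf_le_const summableI) auto
  ultimately show ?thesis by simp
qed

lemma cover_sum_antimono:
  assumes "\<And>U. U \<in> \<U> \<Longrightarrow> diameter U \<in> {0..1}" "t \<le> s"
  shows "cover_sum s \<U> \<le> cover_sum t \<U>"
  unfolding cover_sum_def
  by (intro infsum_mono nonneg_summable_on_complete ennreal_leI powr_mono')
    (use assms in auto)

text \<open>
  A bounded potential on \<open>E\<close> bounds the mass of small sets. A point of \<open>E\<close> inside the set is where the
  potential is evaluated; a set that misses \<open>E\<close> has no mass at all.
\<close>

lemma measure_le_diameter_powr:
  fixes \<nu> :: "(real ^ 'n) measure"
  assumes \<nu>: "\<nu> \<in> prob_measures_on E"
    and \<Phi>: "0 < \<Phi> r" "\<Phi> r \<le> diameter U" "diameter U \<le> r" and "0 \<le> s" "0 < M"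
    and potential: "\<And>x. x \<in> E \<Longrightarrow> (LINT y|\<nu>. gauge_kernel \<Phi> r s m (x - y)) \<le> M * \<Phi> r powr s"
    and "bounded U" "U \<in> sets borel"
  shows "measure \<nu> U \<le> M * diameter U powr s"
proof (cases "U \<inter> E = {}")
  interpret prob_space \<nu> using \<nu> by (simp add: prob_measures_on_def)
  case True
  have "AE x in \<nu>. x \<notin> U"
    using \<nu> True by (auto simp: prob_measures_on_def elim!: eventually_mono)
  then have "measure \<nu> U = 0" using assms by (subst prob_eq_0) (auto simp: prob_measures_on_def)
  then show ?thesis using assms by simp
next
  interpret prob_space \<nu> using \<nu> by (simp add: prob_measures_on_def)
  case False
  then obtain x where x: "x \<in> U" "x \<in> E" by auto
  let ?d = "diameter U"
  have U: "U \<in> sets \<nu>" using \<nu> assms by (simp add: prob_measures_on_def)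
  have "(\<Phi> r / ?d) powr s * measure \<nu> U = (LINT y|\<nu>. (\<Phi> r / ?d) powr s * indicator U y)"
    using U by simp
  also have "\<dots> \<le> (LINT y|\<nu>. gauge_kernel \<Phi> r s m (x - y))"
  proof (rule integral_mono)
    show "integrable \<nu> (\<lambda>y. (\<Phi> r / ?d) powr s * indicator U y)"
      using U by (intro integrable_mult_right integrable_real_indicator) (auto simp: emeasure_eq_measure)
    show "integrable \<nu> (\<lambda>y. gauge_kernel \<Phi> r s m (x - y))"
      using \<Phi> \<open>0 \<le> s\<close> by (intro integrable_gauge_kernel[OF \<nu>]) auto
    fix y
    have "norm (x - y) \<le> ?d" if "y \<in> U"
      using diameter_bounded_bound[OF \<open>bounded U\<close> x(1) that] by (simp add: dist_norm)
    then show "(\<Phi> r / ?d) powr s * indicator U y \<le> gauge_kernel \<Phi> r s m (x - y)"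
      using \<Phi> \<open>0 \<le> s\<close> gauge_kernel_nonneg[of r \<Phi> s m "x - y"]
      by (auto simp: indicator_def intro!: gauge_kernel_ge_near)
  qed
  also have "\<dots> \<le> M * \<Phi> r powr s" by (rule potential) fact
  finally have "\<Phi> r powr s * (measure \<nu> U / ?d powr s) \<le> \<Phi> r powr s * M"
    using \<Phi> by (simp add: powr_divide mult_ac)
  then have "measure \<nu> U / ?d powr s \<le> M"
    by (rule mult_left_le_imp_le) (use \<Phi> in simp)
  then show ?thesis using \<Phi> by (simp add: divide_simps)
qed

text \<open>
  The members of a cover need not be measurable. Passing to closures keeps the diameters.
\<close>

lemma one_le_cover_sum:
  fixes \<nu> :: "(real ^ 'n) measure"
  assumes \<nu>: "\<nu> \<in> prob_measures_on E" and "0 < \<Phi> r" "0 \<le> s" "0 < M"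
    and potential: "\<And>x. x \<in> E \<Longrightarrow> (LINT y|\<nu>. gauge_kernel \<Phi> r s m (x - y)) \<le> M * \<Phi> r powr s"
    and cover: "gauge_cover \<Phi> r E \<U>"
  shows "1 \<le> ennreal M * cover_sum s \<U>"
proof -
  interpret prob_space \<nu> using \<nu> by (simp add: prob_measures_on_def)
  have [measurable_cong]: "sets \<nu> = sets borel" and AE: "AE x in \<nu>. x \<in> E"
    using \<nu> by (auto simp: prob_measures_on_def)
  have "countable \<U>" and sub: "E \<subseteq> \<Union>\<U>"
    and members: "\<And>U. U \<in> \<U> \<Longrightarrow> bounded U \<and> \<Phi> r \<le> diameter U \<and> diameter U \<le> r"
    using cover by (auto simp: gauge_cover_def)
  have mass: "emeasure \<nu> (closure U) \<le> ennreal M * ennreal (diameter U powr s)" if "U \<in> \<U>" for U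
  proof -
    have "measure \<nu> (closure U) \<le> M * diameter (closure U) powr s"
      using members[OF that] assms
      by (intro measure_le_diameter_powr[where \<Phi> = \<Phi> and r = r and m = m and E = E])
        (auto simp: diameter_closure)
    then show ?thesis
      using members[OF that] \<open>0 < M\<close>
      by (simp add: emeasure_eq_measure diameter_closure flip: ennreal_mult')
  qed
  have "(\<Union>U\<in>\<U>. closure U) \<in> sets \<nu>"
    using \<open>countable \<U>\<close> by (intro sets.countable_UN') auto
  moreover have "E \<subseteq> (\<Union>U\<in>\<U>. closure U)"
    using sub closure_subset by blast
  then have "AE x in \<nu>. x \<in> (\<Union>U\<in>\<U>. closure U)"
    using AE by (auto elim!: eventually_mono)
  ultimately have "1 = emeasure \<nu> (\<Union>U\<in>\<U>. closure U)"
    by (simp add: emeasure_eq_1_AE)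
  also have "\<dots> \<le> (\<Sum>\<^sub>\<infinity>U\<in>\<U>. emeasure \<nu> (closure U))"
    using \<open>countable \<U>\<close> by (intro emeasure_UN_le_infsum) auto
  also have "\<dots> \<le> ennreal M * cover_sum s \<U>"
    unfolding nonneg_infsum_complete[OF zero_le]
  proof (intro SUP_least)
    fix \<F> assume "\<F> \<in> {\<F>. finite \<F> \<and> \<F> \<subseteq> \<U>}"
    then have \<F>: "finite \<F>" "\<F> \<subseteq> \<U>" by auto
    have "(\<Sum>U\<in>\<F>. emeasure \<nu> (closure U)) \<le> (\<Sum>U\<in>\<F>. ennreal M * ennreal (diameter U powr s))"
      using mass \<F> by (intro sum_mono) auto
    also have "\<dots> = ennreal M * (\<Sum>U\<in>\<F>. ennreal (diameter U powr s))"
      by (rule sum_distrib_left[symmetric])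
    also have "\<dots> \<le> ennreal M * cover_sum s \<U>"
      unfolding cover_sum_def nonneg_infsum_complete[OF zero_le]
      using \<F> by (intro mult_left_mono SUP_upper) auto
    finally show "(\<Sum>U\<in>\<F>. emeasure \<nu> (closure U)) \<le> ennreal M * cover_sum s \<U>" .
  qed
  finally show ?thesis .
qed

lemma lower_intermediate_dim_ge:
  fixes \<nu> :: "(real ^ 'n) measure"
  assumes "admissible_gauge \<Phi>" "\<nu> \<in> prob_measures_on E" "0 \<le> s" "0 < M"
    and potential: "\<forall>\<^sub>F r in at_right 0. \<forall>x\<in>E.
      (LINT y|\<nu>. gauge_kernel \<Phi> r s m (x - y)) \<le> M * \<Phi> r powr s"
  shows "ereal s \<le> lower_intermediate_dim \<Phi> E"
  unfolding lower_intermediate_dim_def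
proof (intro Inf_greatest, safe)
  fix t :: real
  assume "0 \<le> t"
    and small: "\<forall>\<epsilon>>0. \<forall>r0>0. \<exists>r. 0 < r \<and> r \<le> r0 \<and>
      (\<exists>\<U>. gauge_cover \<Phi> r E \<U> \<and> cover_sum t \<U> \<le> ennreal \<epsilon>)"
  show "ereal s \<le> ereal t"
  proof (rule ccontr)
    assume "\<not> ereal s \<le> ereal t"
    then have "t \<le> s" by simp
    have "\<forall>\<^sub>F r in at_right 0. r \<le> 1 \<and> 0 < \<Phi> r \<and>
        (\<forall>x\<in>E. (LINT y|\<nu>. gauge_kernel \<Phi> r s m (x - y)) \<le> M * \<Phi> r powr s)"
      using potential admissible_gauge_eventually[OF \<open>admissible_gauge \<Phi>\<close> zero_less_one]
      by eventually_elim auto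
    then obtain r1 where "0 < r1" and good: "\<And>r. 0 < r \<Longrightarrow> r < r1 \<Longrightarrow> r \<le> 1 \<and> 0 < \<Phi> r \<and>
        (\<forall>x\<in>E. (LINT y|\<nu>. gauge_kernel \<Phi> r s m (x - y)) \<le> M * \<Phi> r powr s)"
      unfolding eventually_at_right_field by blast
    \<comment> \<open>Any cover sum below \<open>1 / M\<close> contradicts \<open>1 \<le> M * cover_sum s \<U>\<close>.\<close>
    have "0 < 1 / (2 * M)" "0 < r1 / 2" using \<open>0 < M\<close> \<open>0 < r1\<close> by auto
    with small obtain r \<U> where r: "0 < r" "r \<le> r1 / 2"
      and \<U>: "gauge_cover \<Phi> r E \<U>" "cover_sum t \<U> \<le> ennreal (1 / (2 * M))"
      by blast
    have pot: "r \<le> 1" "0 < \<Phi> r"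
      "\<And>x. x \<in> E \<Longrightarrow> (LINT y|\<nu>. gauge_kernel \<Phi> r s m (x - y)) \<le> M * \<Phi> r powr s"
      using good[of r] r \<open>0 < r1\<close> by auto
    have "1 \<le> ennreal M * cover_sum s \<U>"
      using assms pot \<U> by (intro one_le_cover_sum) auto
    also have "\<dots> \<le> ennreal M * cover_sum t \<U>"
      using \<U> pot \<open>t \<le> s\<close>
      by (intro mult_left_mono cover_sum_antimono) (force simp: gauge_cover_def)+
    also have "\<dots> \<le> ennreal M * ennreal (1 / (2 * M))"
      using \<U> by (intro mult_left_mono) auto
    also have "\<dots> = ennreal (1 / 2)"
      using \<open>0 < M\<close> by (simp flip: ennreal_mult')
    finally have "ennreal 1 \<le> ennreal (1 / 2)" by simp
    then show False by (subst (asm) ennreal_le_iff) auto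
  qed
qed

lemma lower_le_upper_intermediate_dim:
  "lower_intermediate_dim \<Phi> E \<le> upper_intermediate_dim \<Phi> E"
  unfolding lower_intermediate_dim_def upper_intermediate_dim_def
proof (rule Inf_superset_mono, rule subsetI)
  fix x
  assume "x \<in> {ereal t | t. 0 \<le> t \<and> (\<forall>\<epsilon>>0. \<exists>r0>0. \<forall>r. 0 < r \<and> r \<le> r0 \<longrightarrow>
      (\<exists>\<U>. gauge_cover \<Phi> r E \<U> \<and> cover_sum t \<U> \<le> ennreal \<epsilon>))}"
  then obtain t where t: "x = ereal t" "0 \<le> t"
    and upper: "\<forall>\<epsilon>>0. \<exists>r0>0. \<forall>r. 0 < r \<and> r \<le> r0 \<longrightarrow>
      (\<exists>\<U>. gauge_cover \<Phi> r E \<U> \<and> cover_sum t \<U> \<le> ennreal \<epsilon>)"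
    by blast
  have "\<exists>r. 0 < r \<and> r \<le> r0 \<and> (\<exists>\<U>. gauge_cover \<Phi> r E \<U> \<and> cover_sum t \<U> \<le> ennreal \<epsilon>)"
    if "0 < \<epsilon>" "0 < r0" for \<epsilon> r0
  proof -
    obtain r1 where "0 < r1" and r1: "\<forall>r. 0 < r \<and> r \<le> r1 \<longrightarrow>
        (\<exists>\<U>. gauge_cover \<Phi> r E \<U> \<and> cover_sum t \<U> \<le> ennreal \<epsilon>)"
      using upper[rule_format, OF \<open>0 < \<epsilon>\<close>] by (elim exE conjE)
    with that have "0 < min r0 r1" "min r0 r1 \<le> r0" "min r0 r1 \<le> r1" by auto
    with r1 show ?thesis by (intro exI[of _ "min r0 r1"] conjI) simp_all
  qed
  with t show "x \<in> {ereal t | t. 0 \<le> t \<and> (\<forall>\<epsilon>>0. \<forall>r0>0. \<exists>r. 0 < r \<and> r \<le> r0 \<and>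
      (\<exists>\<U>. gauge_cover \<Phi> r E \<U> \<and> cover_sum t \<U> \<le> ennreal \<epsilon>))}"
    unfolding mem_Collect_eq by - (rule exI[of _ t], simp)
qed

theorem proposition9:
  fixes F :: "(real ^ 'n) set" and \<Phi> :: "real \<Rightarrow> real" and m :: nat and s r0 M :: real
    and \<nu> :: "(real ^ 'n) measure"
  assumes "bounded F"
    and "admissible_gauge \<Phi>"
    and "1 \<le> m" and "m \<le> CARD('n)"
    and "s \<in> {0..real m}"
    and "r0 > 0" and "M > 0"
    and "\<nu> \<in> prob_measures_on F"
    and "\<And>r x. \<lbrakk>0 < r; r \<le> r0; r \<le> 1; \<Phi> r \<le> r; x \<in> F\<rbrakk> \<Longrightarrow>
           (LINT y|\<nu>. gauge_kernel \<Phi> r s m (x - y)) \<le> M * \<Phi> r powr s"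
  shows "lower_dim_profile \<Phi> m F \<ge> ereal s \<and> upper_dim_profile \<Phi> m F \<ge> ereal s \<and>
    (m = CARD('n) \<longrightarrow>
       lower_intermediate_dim \<Phi> F \<ge> ereal s \<and> upper_intermediate_dim \<Phi> F \<ge> ereal s)"
proof -
  let ?q = "\<lambda>r. ereal (ln (gauge_capacity \<Phi> r s m F) / - ln (\<Phi> r))"
  have potential: "\<forall>\<^sub>F r in at_right 0. \<forall>x\<in>F.
      (LINT y|\<nu>. gauge_kernel \<Phi> r s m (x - y)) \<le> M * \<Phi> r powr s"
    using admissible_gauge_eventually[OF \<open>admissible_gauge \<Phi>\<close> \<open>r0 > 0\<close>]
    by eventually_elim (use assms(9) in auto)
  have Liminf: "ereal s \<le> Liminf (at_right 0) ?q"
    using assms potential by (intro Liminf_ln_gauge_capacity_ge) auto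
  also have "\<dots> \<le> Limsup (at_right 0) ?q"
    by (intro Liminf_le_Limsup) auto
  finally have Limsup: "ereal s \<le> Limsup (at_right 0) ?q" .
  have "ereal s \<le> lower_dim_profile \<Phi> m F"
    unfolding lower_dim_profile_def using Liminf assms(5) by (intro Sup_upper) blast
  moreover have "ereal s \<le> upper_dim_profile \<Phi> m F"
    unfolding upper_dim_profile_def using Limsup assms(5) by (intro Sup_upper) blast
  moreover have "ereal s \<le> lower_intermediate_dim \<Phi> F"
    using assms potential by (intro lower_intermediate_dim_ge) auto
  ultimately show ?thesis
    using lower_le_upper_intermediate_dim[of \<Phi> F] by (auto intro: order_trans)
qed

end
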